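(* Let $d\ge 3$ and $n\ge 2$ be integers, $\delta=(d-1)/2$, and let $\mu$ be a spherically symmetric probability measure on $\mathbb{R}^d$ with finite second moment. Let $M_{\Psi,k}=\int \|\mathbf{x}\|^k\,\mu(\mathrm{d}\mathbf{x})$ for $k=1,2$. Let $\widehat{a^*}=\widehat{a^*}(d,n,2)$ be the value of $a\ge 0$ that minimises the extreme-value approximation $\widehat E_{\mu,2}(n;a)$ of the $L_2$-mean quantisation error for random quantisers made of $n$ i.i.d. points uniform on the sphere of radius $a$ (defined in the context). Then $$\widehat{a^*}(d,n,2)=M_{\Psi,1}\left[1-2\,\kappa_{n,d}\,\Gamma(1+1/\delta)\right],\qquad \widehat E_{\mu,2}^2(n;\widehat{a^*})=M_{\Psi,2}-(\widehat{a^*})^2 .$$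
   Context: A probability measure on $\mathbb{R}^d$ is spherically symmetric if it is the distribution of $R\cdot Z$ with $R\ge 0$ a random variable and $Z$ uniform on the unit sphere, independent of $R$. For $d\ge 3$ and $\delta=(d-1)/2$, $\kappa_{n,d}$ denotes the $1/n$ quantile of the Beta$(\delta,\delta)$ distribution, i.e. $I_{\kappa_{n,d}}(\delta,\delta)=1/n$ with $I_t(p,q)$ the regularised incomplete Beta function, and $F_d(t)=1-\exp(-t^\delta)$, $t\ge0$, is a Weibull c.d.f. Let $\Psi$ be the c.d.f. of $\|U\|$ when $U$ has distribution $\mu$. For $s>0$ and $a\ge 0$ the extreme-value approximation of the $(\mu,s)$-distortion is defined by $$\widehat E_{\mu,s}^s(n;a)=\int_{r\ge0}\int_{\zeta\ge0}\left[(r-a)^2+4\,a\,r\,\kappa_{n,d}\,\zeta\right]^{s/2}\,\mathrm{d}F_d(\zeta)\,\mathrm{d}\Psi(r),$$ and $\widehat E_{\mu,s}(n;a)=\left[\widehat E_{\mu,s}^s(n;a)\right]^{1/s}$. *)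

theory Defs
  imports "HOL-Probability.Probability"
begin

text \<open>
  Normalised surface measure on the unit sphere, obtained by radially projecting the uniform
  distribution on the unit ball; \<open>sgn x = x /\<^sub>R norm x\<close>, and the centre, where
  \<open>sgn\<close> is 0, is a null set.
\<close>

definition uniform_sphere :: "(real ^ 'd) measure" where
  "uniform_sphere = distr (uniform_measure lborel (ball 0 1)) borel sgn"

text \<open>
  The sample space may be taken to be \<open>real \<times> real ^ 'd\<close> without loss of generality: whatever the
  space on which \<open>R\<close> and \<open>Z\<close> are given, they can be replaced by the coordinate projections under
  their joint law. Independence is spelled out with \<open>indep_set\<close>, because \<open>indep_var\<close> requires
  both variables to take values in the same type.
\<close>

definition spherically_symmetric :: "(real ^ 'd) measure \<Rightarrow> bool" where
  "spherically_symmetric \<mu> \<longleftrightarrow>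
     (\<exists>(M :: (real \<times> real ^ 'd) measure) (R :: real \<times> real ^ 'd \<Rightarrow> real)
        (Z :: real \<times> real ^ 'd \<Rightarrow> real ^ 'd).
        prob_space M \<and> R \<in> borel_measurable M \<and> Z \<in> borel_measurable M \<and>
        prob_space.indep_set M {R -` A \<inter> space M | A. A \<in> sets borel}
                               {Z -` B \<inter> space M | B. B \<in> sets borel} \<and>
        (\<forall>\<omega>\<in>space M. 0 \<le> R \<omega>) \<and>
        distr M borel Z = uniform_sphere \<and>
        \<mu> = distr M borel (\<lambda>\<omega>. R \<omega> *\<^sub>R Z \<omega>))"

definition radial_moment :: "(real ^ 'd) measure \<Rightarrow> nat \<Rightarrow> real" where
  "radial_moment \<mu> k = (LINT x|\<mu>. norm x ^ k)"

definition radial_cdf :: "(real ^ 'd) measure \<Rightarrow> real \<Rightarrow> real" where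
  "radial_cdf \<mu> = cdf (distr \<mu> borel norm)"

definition dim_delta :: "nat \<Rightarrow> real" where
  "dim_delta d = (real d - 1) / 2"

definition reg_inc_beta :: "real \<Rightarrow> real \<Rightarrow> real \<Rightarrow> real" where
  "reg_inc_beta t p q = integral {0..t} (\<lambda>x. x powr (p - 1) * (1 - x) powr (q - 1)) / Beta p q"

definition beta_quantile :: "nat \<Rightarrow> nat \<Rightarrow> real" where
  "beta_quantile n d =
     (THE t. 0 \<le> t \<and> t \<le> 1 \<and> reg_inc_beta t (dim_delta d) (dim_delta d) = 1 / real n)"

text \<open>
  Extended by 0 to the negative half-line, so that it induces a Stieltjes measure on all of
  \<open>real\<close>.
\<close>

definition weibull_cdf :: "nat \<Rightarrow> real \<Rightarrow> real" where
  "weibull_cdf d t = (if t < 0 then 0 else 1 - exp (- (t powr dim_delta d)))"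

text \<open>
  The \<open>s\<close>-th power of the extreme-value approximation of the distortion, with \<open>d\<close> read off
  from the type. The integrals over the closed half-line \<open>{0..}\<close> include the mass of an atom
  at 0.
\<close>

definition ev_distortion_pow :: "(real ^ 'd) measure \<Rightarrow> real \<Rightarrow> nat \<Rightarrow> real \<Rightarrow> real" where
  "ev_distortion_pow \<mu> s n a =
     (LINT r:{0..}|interval_measure (radial_cdf \<mu>).
       (LINT \<zeta>:{0..}|interval_measure (weibull_cdf CARD('d)).
          ((r - a)\<^sup>2 + 4 * a * r * beta_quantile n CARD('d) * \<zeta>) powr (s / 2)))"

definition ev_distortion :: "(real ^ 'd) measure \<Rightarrow> real \<Rightarrow> nat \<Rightarrow> real \<Rightarrow> real" where
  "ev_distortion \<mu> s n a = ev_distortion_pow \<mu> s n a powr (1 / s)"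

definition optimal_radius :: "(real ^ 'd) measure \<Rightarrow> real \<Rightarrow> nat \<Rightarrow> real" where
  "optimal_radius \<mu> s n = (THE a. is_arg_min (ev_distortion \<mu> s n) (\<lambda>a. 0 \<le> a) a)"

end

theory Submission
  imports Defs
begin

text \<open>
  For \<open>s = 2\<close> the integrand is affine in \<open>\<zeta>\<close>, so the double integral only involves the Weibull
  mean \<open>\<Gamma>(1 + 1/\<delta>)\<close> and the first two moments of the norm: for \<open>a \<ge> 0\<close> it equals
  \<open>a\<^sup>2 - 2 c a + M\<^sub>2\<close> with \<open>c = M\<^sub>1 (1 - 2 \<kappa> \<Gamma>(1 + 1/\<delta>))\<close>. The vertex \<open>c\<close> of this parabola
  is admissible: \<open>\<kappa> \<le> 1/2\<close> because the Beta density is symmetric about \<open>1/2\<close> and \<open>n \<ge> 2\<close>, and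
  \<open>\<Gamma> \<le> 1\<close> on \<open>[1, 2]\<close> because \<open>ln \<circ> \<Gamma>\<close> is convex and vanishes at both endpoints.
\<close>

text \<open>Both Stieltjes integrals in the distortion thereby become integrals against explicit
  image measures: a law on the line is determined by its cdf.\<close>

lemma interval_measure_cdf:
  assumes "real_distribution M"
  shows "interval_measure (cdf M) = M"
proof -
  interpret real_distribution M by fact
  have "real_distribution (interval_measure (cdf M))"
    by (intro real_distribution_interval_measure cdf_nondecreasing cdf_is_right_cont
        cdf_lim_at_bot cdf_lim_at_top_prob)
  moreover have "cdf (interval_measure (cdf M)) = cdf M"
    unfolding cdf_def[of "interval_measure (cdf M)"]
    by (intro ext measure_interval_measure_Iic cdf_nondecreasing cdf_is_right_cont cdf_lim_at_bot)
  ultimately show ?thesis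
    using assms cdf_unique by blast
qed

text \<open>If X is standard exponential, then \<open>X powr (1 / \<delta>)\<close> is at most t
  exactly when X is at most \<open>t powr \<delta>\<close>, for t nonnegative.\<close>

lemma interval_measure_weibull_cdf:
  assumes "dim_delta d > 0"
  shows "interval_measure (weibull_cdf d) =
    distr (density lborel (exponential_density 1)) borel (\<lambda>x. x powr (1 / dim_delta d))"
    (is "_ = distr ?E borel ?g")
proof -
  let ?\<delta> = "dim_delta d"
  interpret E: prob_space ?E
    by (rule prob_space_exponential_density) simp
  have real: "real_distribution (distr ?E borel ?g)"
    by (intro E.real_distribution_distr) measurable
  have "weibull_cdf d t = cdf (distr ?E borel ?g) t" for t
  proof (cases "t < 0")
    case True
    \<comment> \<open>\<open>powr\<close> has no negative values, even at negative bases.\<close>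
    then have "?g -` {..t} = {}"
      by (auto simp del: powr_ge_zero dest!: order_trans[OF powr_ge_zero])
    with True show ?thesis
      by (simp add: weibull_cdf_def cdf_def measure_distr)
  next
    case False
    have AE: "AE x in ?E. 0 \<le> x"
      by (subst AE_density) (auto simp: erlang_density_def)
    have "cdf (distr ?E borel ?g) t = measure ?E (?g -` {..t})"
      by (simp add: cdf_def measure_distr)
    \<comment> \<open>The two powers are mutually inverse only on the nonnegative half-line, so the
      sets are compared almost everywhere; the exponential law does not charge negative x.\<close>
    also have "\<dots> = measure ?E {..t powr ?\<delta>}"
    proof (rule E.finite_measure_eq_AE)
      show "AE x in ?E. (x \<in> ?g -` {..t}) = (x \<in> {..t powr ?\<delta>})"
        using AE
      proof eventually_elim
        case (elim x)
        have "x powr (1 / ?\<delta>) \<le> t" if "x \<le> t powr ?\<delta>"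
          using powr_mono2[OF _ elim that, of "1 / ?\<delta>"] assms False by (simp add: powr_powr)
        moreover have "x \<le> t powr ?\<delta>" if "x powr (1 / ?\<delta>) \<le> t"
          using powr_mono2[OF _ _ that, of ?\<delta>] assms elim by (simp add: powr_powr)
        ultimately show ?case by auto
      qed
    qed (auto intro!: measurable_sets_borel[of _ borel])
    also have "\<dots> = 1 - exp (- (t powr ?\<delta>))"
      by (simp add: measure_def emeasure_erlang_density erlang_CDF_def)
    finally show ?thesis
      using False by (simp add: weibull_cdf_def)
  qed
  then have "weibull_cdf d = cdf (distr ?E borel ?g)" by auto
  then show ?thesis
    using interval_measure_cdf[OF real] by simp
qed

text \<open>The moment is Euler's integral for Gamma at \<open>1 + p\<close>, which converges at 0
  because \<open>p > -1\<close>.\<close>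

lemma exponential_moment_powr:
  assumes "p > -1"
  shows "has_bochner_integral (density lborel (exponential_density 1))
    (\<lambda>x. x powr p) (Gamma (1 + p))"
proof (rule has_bochner_integral_nn_integral)
  have "(\<integral>\<^sup>+x. ennreal (x powr p) \<partial>density lborel (exponential_density 1)) =
      (\<integral>\<^sup>+x. ennreal (indicator {0..} x * x powr (1 + p - 1) / exp x) \<partial>lborel)"
    by (subst nn_integral_density)
      (auto intro!: nn_integral_cong simp: erlang_density_def exp_minus field_simps
        ennreal_mult'[symmetric] split: split_indicator)
  also have "\<dots> = Gamma (1 + p)"
    using assms by (intro Gamma_conv_nn_integral_real[symmetric]) simp
  finally show "(\<integral>\<^sup>+x. ennreal (x powr p) \<partial>density lborel (exponential_density 1)) =
    ennreal (Gamma (1 + p))" .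
qed (use assms in auto)

text \<open>The exponent 1 is \<open>s / 2\<close> at \<open>s = 2\<close>. The signs of
  \<open>b\<close> and \<open>c\<close> keep the base nonnegative, where \<open>powr 1\<close> is
  the identity; what remains is the Weibull mean, an exponential moment of order
  \<open>1 / \<delta>\<close>.\<close>

lemma weibull_integral_affine:
  fixes b c :: real
  assumes "dim_delta d > 0" "0 \<le> b" "0 \<le> c"
  shows "(LINT \<zeta>:{0..}|interval_measure (weibull_cdf d). (b + c * \<zeta>) powr 1) =
    b + c * Gamma (1 + 1 / dim_delta d)"
proof -
  let ?E = "density lborel (exponential_density 1)"
  let ?p = "1 / dim_delta d"
  interpret E: prob_space ?E
    by (rule prob_space_exponential_density) simp
  have p: "has_bochner_integral ?E (\<lambda>x. x powr ?p) (Gamma (1 + ?p))"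
    using assms(1) by (intro exponential_moment_powr) (rule less_le_trans[of _ 0], simp_all)
  have "(LINT \<zeta>:{0..}|interval_measure (weibull_cdf d). (b + c * \<zeta>) powr 1) =
      (LINT x|?E. b + c * x powr ?p)"
    using assms(2,3)
    by (simp add: interval_measure_weibull_cdf[OF assms(1)] set_lebesgue_integral_def integral_distr)
  also have "\<dots> = b + c * Gamma (1 + ?p)"
    using p E.prob_space by (simp add: has_bochner_integral_iff)
  finally show ?thesis .
qed

lemma Gamma_real_le_1:
  assumes "1 \<le> x" "x \<le> 2"
  shows "Gamma (x :: real) \<le> 1"
proof -
  have "(ln \<circ> Gamma) ((1 - (x - 1)) *\<^sub>R 1 + (x - 1) *\<^sub>R 2) \<le>
      (1 - (x - 1)) * (ln \<circ> Gamma) 1 + (x - 1) * (ln \<circ> Gamma) (2::real)"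
    using assms by (intro convex_onD[OF log_convex_Gamma_real]) auto
  moreover have "Gamma (2::real) = 1"
    using Gamma_fact[of 1, where 'a = real] by simp
  ultimately have "ln (Gamma x) \<le> 0"
    by (simp add: algebra_simps)
  moreover have "Gamma x > 0"
    using assms by (intro Gamma_real_pos) simp
  ultimately show ?thesis by simp
qed

lemma reg_inc_beta_continuous_on:
  assumes "p > 0" "q > 0"
  shows "continuous_on {0..1} (\<lambda>t. reg_inc_beta t p q)"
  unfolding reg_inc_beta_def
  using has_integral_Beta_real[OF assms] assms
  by (intro continuous_intros indefinite_integral_continuous_1)
    (force simp: Beta_def Gamma_eq_zero_iff)+

lemma reg_inc_beta_strict_mono_on:
  assumes "p > 0" "q > 0"
  shows "strict_mono_on {0..1} (\<lambda>t. reg_inc_beta t p q)"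
proof (rule strict_mono_onI)
  fix s t :: real
  assume st: "s \<in> {0..1}" "t \<in> {0..1}" "s < t"
  let ?f = "\<lambda>x. x powr (p - 1) * (1 - x) powr (q - 1)"
  \<comment> \<open>Points strictly inside the interval: on \<open>{u..v}\<close> the integrand is
    continuous and positive, while at 0 and 1 it may vanish or have a singularity nearby.\<close>
  define u v where "u = (2 * s + t) / 3" and "v = (s + 2 * t) / 3"
  have uv: "s < u" "u < v" "v < t"
    using st by (auto simp: u_def v_def field_simps)
  have int: "?f integrable_on {0..1}"
    using has_integral_Beta_real[OF assms] by blast
  have int': "?f integrable_on {a..b}" if "0 \<le> a" "b \<le> 1" for a b
    using that by (intro integrable_on_subinterval[OF int]) auto
  have "0 = integral {u..v} (\<lambda>x. 0 :: real)" by simp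
  also have "\<dots> < integral {u..v} ?f"
    using st uv by (intro integral_less_real continuous_intros) auto
  also have "\<dots> \<le> integral {s..t} ?f"
    using st uv by (intro integral_subset_le int') auto
  also have "\<dots> = integral {0..t} ?f - integral {0..s} ?f"
    using Henstock_Kurzweil_Integration.integral_combine[of 0 s t ?f] int'[of 0 t] st by simp
  finally have "integral {0..s} ?f < integral {0..t} ?f" by simp
  moreover have "Beta p q > 0"
    using assms by (auto simp: Beta_def intro!: divide_pos_pos mult_pos_pos)
  ultimately show "reg_inc_beta s p q < reg_inc_beta t p q"
    by (simp add: reg_inc_beta_def divide_strict_right_mono)
qed

lemma reg_inc_beta_half:
  assumes "p > 0"
  shows "reg_inc_beta (1 / 2) p p = 1 / 2"
proof -
  let ?f = "\<lambda>x::real. x powr (p - 1) * (1 - x) powr (p - 1)"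
  have tot: "(?f has_integral Beta p p) {0..1}"
    by (rule has_integral_Beta_real[OF assms assms])
  have "(?f has_integral integral {0..1/2} ?f) {0..1/2}"
    by (intro integrable_integral integrable_on_subinterval[OF has_integral_integrable[OF tot]]) auto
  \<comment> \<open>The reflection of x to \<open>1 - x\<close> exchanges the two halves of the unit
    interval and, the parameters being equal, only swaps the two factors of the integrand.\<close>
  from has_integral_affinity[OF this[folded box_real(2)], of "-1" 1]
  have "((\<lambda>x. ?f (1 - x)) has_integral integral {0..1/2} ?f) ((\<lambda>x. 1 - x) ` {0..1/2})"
    by (simp add: image_comp o_def)
  then have "integral {1/2..1} ?f = integral {0..1/2} ?f"
    by (simp add: integral_unique mult.commute)
  moreover have "integral {0..1/2} ?f + integral {1/2..1} ?f = Beta p p"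
    using Henstock_Kurzweil_Integration.integral_combine[of 0 "1/2" 1 ?f] tot
    by (auto simp: integral_unique)
  moreover have "Beta p p > 0"
    using assms by (auto simp: Beta_def intro!: divide_pos_pos mult_pos_pos)
  ultimately show ?thesis
    by (simp add: reg_inc_beta_def field_simps)
qed

text \<open>The quantile is a definite description, so its root must exist and be unique. The values
  0 at 0 and 1/2 at 1/2 enclose \<open>1 / n\<close>, which gives a root in the left half; strict
  monotonicity excludes any other in the unit interval.\<close>

lemma beta_quantile_bounds:
  assumes "dim_delta d > 0" "n \<ge> 2"
  shows "0 \<le> beta_quantile n d" "beta_quantile n d \<le> 1 / 2"
proof -
  let ?F = "\<lambda>t. reg_inc_beta t (dim_delta d) (dim_delta d)"
  have "\<exists>t\<ge>0. t \<le> 1 / 2 \<and> ?F t = 1 / real n"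
  proof (rule IVT')
    show "?F 0 \<le> 1 / real n" by (simp add: reg_inc_beta_def)
    show "1 / real n \<le> ?F (1 / 2)"
      using assms by (simp add: reg_inc_beta_half field_simps)
    show "continuous_on {0..1 / 2} ?F"
      by (rule continuous_on_subset[OF reg_inc_beta_continuous_on]) (use assms in auto)
  qed auto
  then obtain t where t: "0 \<le> t" "t \<le> 1 / 2" "?F t = 1 / real n" by blast
  have "beta_quantile n d = t"
    unfolding beta_quantile_def
  proof (rule the_equality)
    fix s assume "0 \<le> s \<and> s \<le> 1 \<and> ?F s = 1 / real n"
    then show "s = t"
      using strict_mono_on_imp_inj_on[OF reg_inc_beta_strict_mono_on[OF assms(1) assms(1)]] t
      by (elim inj_onD[where f = ?F]) auto
  qed (use t in auto)
  with t show "0 \<le> beta_quantile n d" "beta_quantile n d \<le> 1 / 2" by auto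
qed

lemma ev_distortion_pow_2:
  fixes \<mu> :: "(real ^ 'd) measure"
  assumes "dim_delta CARD('d) > 0" "n \<ge> 2"
    and "prob_space \<mu>" and sets: "sets \<mu> = sets borel"
    and int2: "integrable \<mu> (\<lambda>x. (norm x)\<^sup>2)"
    and "0 \<le> a"
  defines "c \<equiv> radial_moment \<mu> 1 *
    (1 - 2 * beta_quantile n CARD('d) * Gamma (1 + 1 / dim_delta CARD('d)))"
  shows "ev_distortion_pow \<mu> 2 n a = (a - c)\<^sup>2 + (radial_moment \<mu> 2 - c\<^sup>2)"
proof -
  interpret prob_space \<mu> by fact
  let ?\<kappa> = "beta_quantile n CARD('d)"
  let ?m = "Gamma (1 + 1 / dim_delta CARD('d))"
  let ?I = "\<lambda>r. LINT \<zeta>:{0..}|interval_measure (weibull_cdf CARD('d)).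
          ((r - a)\<^sup>2 + 4 * a * r * ?\<kappa> * \<zeta>) powr (2 / 2)"
  have [measurable]: "norm \<in> borel_measurable \<mu>"
    by (simp add: sets measurable_cong_sets[OF sets refl])
  have int1: "integrable \<mu> norm"
    using int2 by (rule square_integrable_imp_integrable[rotated]) simp
  \<comment> \<open>For negative r the coefficient of \<zeta> could be negative; the outer integral
    only sees nonnegative r.\<close>
  have I: "?I r = (r - a)\<^sup>2 + 4 * a * r * ?\<kappa> * ?m" if "0 \<le> r" for r
    using weibull_integral_affine[of "CARD('d)" "(r - a)\<^sup>2" "4 * a * r * ?\<kappa>"]
      beta_quantile_bounds(1)[of "CARD('d)" n] assms that by simp
  have "ev_distortion_pow \<mu> 2 n a = (LINT r:{0..}|distr \<mu> borel norm. ?I r)"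
    by (simp add: ev_distortion_pow_def radial_cdf_def interval_measure_cdf)
  also have "\<dots> = (LINT r:{0..}|distr \<mu> borel norm. (r - a)\<^sup>2 + 4 * a * r * ?\<kappa> * ?m)"
    using I by (intro set_lebesgue_integral_cong) auto
  \<comment> \<open>Norms are nonnegative, so the indicator of \<open>{0..}\<close> disappears under
    the change of variables.\<close>
  also have "\<dots> = (LINT x|\<mu>. (norm x)\<^sup>2 - 2 * a * (1 - 2 * ?\<kappa> * ?m) * norm x + a\<^sup>2)"
    by (simp add: set_lebesgue_integral_def integral_distr algebra_simps power2_eq_square)
  also have "\<dots> = radial_moment \<mu> 2 - 2 * a * (1 - 2 * ?\<kappa> * ?m) * radial_moment \<mu> 1 + a\<^sup>2"
    using int1 int2 by (simp add: radial_moment_def prob_space)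
  also have "\<dots> = (a - c)\<^sup>2 + (radial_moment \<mu> 2 - c\<^sup>2)"
    by (simp add: c_def power2_eq_square algebra_simps)
  finally show ?thesis .
qed

lemma ev_distortion_pow_nonneg: "0 \<le> ev_distortion_pow \<mu> s n a"
  by (simp add: ev_distortion_pow_def set_lebesgue_integral_def)

text \<open>Taking the s-th root is strictly increasing on nonnegative reals, so it preserves
  minimisers.\<close>

lemma is_arg_min_ev_distortion:
  assumes "s > 0"
  shows "is_arg_min (ev_distortion \<mu> s n) P a \<longleftrightarrow> is_arg_min (ev_distortion_pow \<mu> s n) P a"
proof -
  have "ev_distortion \<mu> s n x < ev_distortion \<mu> s n y \<longleftrightarrow>
      ev_distortion_pow \<mu> s n x < ev_distortion_pow \<mu> s n y" for x y
    using assms ev_distortion_pow_nonneg[of \<mu> s n x] ev_distortion_pow_nonneg[of \<mu> s n y]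
      powr_less_mono2[of "1 / s"] powr_mono2[of "1 / s"]
    unfolding ev_distortion_def by (meson less_le_not_le linorder_not_le zero_less_divide_1_iff)
  then show ?thesis by (simp add: is_arg_min_def)
qed

theorem corollary4p1:
  fixes \<mu> :: "(real ^ 'd) measure" and n :: nat
  assumes "CARD('d) \<ge> 3" and "n \<ge> 2"
    and "prob_space \<mu>" and "sets \<mu> = sets borel"
    and "spherically_symmetric \<mu>"
    and "integrable \<mu> (\<lambda>x. (norm x)\<^sup>2)"
  shows "(\<exists>!a. is_arg_min (ev_distortion \<mu> 2 n) (\<lambda>a. 0 \<le> a) a) \<and>
    optimal_radius \<mu> 2 n =
      radial_moment \<mu> 1 * (1 - 2 * beta_quantile n CARD('d) * Gamma (1 + 1 / dim_delta CARD('d))) \<and>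
    ev_distortion_pow \<mu> 2 n (optimal_radius \<mu> 2 n) =
      radial_moment \<mu> 2 - (optimal_radius \<mu> 2 n)\<^sup>2"
proof -
  let ?\<kappa> = "beta_quantile n CARD('d)"
  let ?\<delta> = "dim_delta CARD('d)"
  let ?P = "\<lambda>a. is_arg_min (ev_distortion \<mu> 2 n) (\<lambda>a. 0 \<le> a) a"
  define c where "c = radial_moment \<mu> 1 * (1 - 2 * ?\<kappa> * Gamma (1 + 1 / ?\<delta>))"
  \<comment> \<open>This is where dimension at least 3 enters: it puts
    \<open>1 + 1 / ?\<delta>\<close> into the interval from 1 to 2, where Gamma is at most
    1.\<close>
  have \<delta>: "?\<delta> \<ge> 1"
    using assms(1) by (simp add: dim_delta_def)
  have pow: "ev_distortion_pow \<mu> 2 n a = (a - c)\<^sup>2 + (radial_moment \<mu> 2 - c\<^sup>2)" if "0 \<le> a" for a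
    unfolding c_def using assms \<delta> that by (intro ev_distortion_pow_2) auto
  have "2 * ?\<kappa> * Gamma (1 + 1 / ?\<delta>) \<le> 1 * 1"
    using beta_quantile_bounds[of "CARD('d)" n] Gamma_real_le_1[of "1 + 1 / ?\<delta>"] \<delta> assms(2)
    by (intro mult_mono Gamma_real_nonneg) (auto simp: add_pos_nonneg)
  then have "0 \<le> c"
    unfolding c_def by (intro mult_nonneg_nonneg) (auto simp: radial_moment_def)
  \<comment> \<open>Since \<open>c\<close> is itself an admissible radius, comparing a minimiser
    \<open>a\<close> with it forces the square of \<open>a - c\<close> to be at most 0.\<close>
  then have P: "?P a \<longleftrightarrow> a = c" for a
    by (subst is_arg_min_ev_distortion)
      (auto simp: is_arg_min_linorder pow power2_less_eq_zero_iff dest!: spec[of _ c])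
  then have "optimal_radius \<mu> 2 n = c"
    by (simp add: optimal_radius_def)
  with P pow[OF \<open>0 \<le> c\<close>] show ?thesis
    unfolding c_def[symmetric] by auto
qed

end
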